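(* Let $d,m\in\mathbb{N}$. A function $\boldsymbol{\gamma}=(\gamma_{ij})_{i,j=1,\dots,m}:\mathbb{R}^d\to\mathbb{R}^{m\times m}$ is a pseudo-variogram if and only if, for all $t>0$, the function $\exp^\ast(-t\boldsymbol{\gamma}):\mathbb{R}^d\to\mathbb{R}^{m\times m}$, defined componentwise by $\exp^\ast(-t\boldsymbol{\gamma}(\boldsymbol{h}))_{ij}:=\exp(-t\gamma_{ij}(\boldsymbol{h}))$, is a matrix-valued correlation function.
   Context: Random fields are real-vector-valued. An $m$-variate random field $\{\boldsymbol{Z}(\boldsymbol{x})=(Z_1(\boldsymbol{x}),\dots,Z_m(\boldsymbol{x}))^\top,\ \boldsymbol{x}\in\mathbb{R}^d\}$ is second-order stationary if it has constant mean and $\mathrm{Cov}(Z_i(\boldsymbol{x}+\boldsymbol{h}),Z_j(\boldsymbol{x}))$ exists and depends only on $\boldsymbol{h}$ for all $i,j$. It is intrinsically stationary if $\{\boldsymbol{Z}(\boldsymbol{x}+\boldsymbol{h})-\boldsymbol{Z}(\boldsymbol{x}),\ \boldsymbol{x}\in\mathbb{R}^d\}$ is second-order stationary for every $\boldsymbol{h}\in\mathbb{R}^d$. Pseudo-variogram: if $\boldsymbol{Z}$ is intrinsically stationary and, additionally, $Z_i(\boldsymbol{x}+\boldsymbol{h})-Z_j(\boldsymbol{x})$ is square integrable with $\mathrm{Var}(Z_i(\boldsymbol{x}+\boldsymbol{h})-Z_j(\boldsymbol{x}))$ not depending on $\boldsymbol{x}$, for all $\boldsymbol{x},\boldsymbol{h}\in\mathbb{R}^d$,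 $i,j=1,\dots,m$, then the pseudo-variogram of $\boldsymbol{Z}$ is $\gamma_{ij}(\boldsymbol{h})=\frac12\mathrm{Var}(Z_i(\boldsymbol{x}+\boldsymbol{h})-Z_j(\boldsymbol{x}))$. A function $\boldsymbol{\gamma}$ is called a pseudo-variogram if it is the pseudo-variogram of some such random field. Matrix-valued correlation function: a function $\boldsymbol{C}:\mathbb{R}^d\to\mathbb{R}^{m\times m}$ that is the covariance function $C_{ij}(\boldsymbol{h})=\mathrm{Cov}(Z_i(\boldsymbol{x}+\boldsymbol{h}),Z_j(\boldsymbol{x}))$ of some second-order stationary $m$-variate random field and satisfies $C_{ii}(\boldsymbol{0})=1$, $i=1,\dots,m$. Equivalently, $C_{ii}(\boldsymbol 0)=1$ and $\boldsymbol{C}$ is positive definite, i.e. $C_{ij}(\boldsymbol{h})=C_{ji}(-\boldsymbol{h})$ and $\sum_{i,j=1}^n \boldsymbol{a}_i^\top\boldsymbol{C}(\boldsymbol{x}_i-\boldsymbol{x}_j)\boldsymbol{a}_j\ge 0$ for all $n\in\mathbb{N}$, $\boldsymbol{x}_1,\dots,\boldsymbol{x}_n\in\mathbb{R}^d$, $\boldsymbol{a}_1,\dots,\boldsymbol{a}_n\in\mathbb{R}^m$. *)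

theory Defs
  imports "HOL-Probability.Probability"
begin

definition random_field :: "'w measure \<Rightarrow> (real ^ 'd \<Rightarrow> 'w \<Rightarrow> real ^ 'm) \<Rightarrow> bool" where
  "random_field M Z \<longleftrightarrow> prob_space M \<and> (\<forall>x. Z x \<in> borel_measurable M)"

definition square_integrable :: "'w measure \<Rightarrow> ('w \<Rightarrow> real) \<Rightarrow> bool" where
  "square_integrable M X \<longleftrightarrow> X \<in> borel_measurable M \<and> integrable M (\<lambda>\<omega>. (X \<omega>)\<^sup>2)"

text \<open>Bochner integrals of non-integrable functions are \<open>0\<close>, so this is the covariance only for
  square-integrable \<open>X\<close> and \<open>Y\<close>; below it is applied to such variables only.\<close>

definition covariance :: "'w measure \<Rightarrow> ('w \<Rightarrow> real) \<Rightarrow> ('w \<Rightarrow> real) \<Rightarrow> real" where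
  "covariance M X Y =
     prob_space.expectation M (\<lambda>\<omega>. (X \<omega> - prob_space.expectation M X) * (Y \<omega> - prob_space.expectation M Y))"

lemma covariance_self: "covariance M X X = prob_space.variance M X"
  by (simp add: covariance_def power2_eq_square)

text \<open>Existence of all covariances \<open>Cov (Z\<^sub>i (x + h), Z\<^sub>j x)\<close> includes, for \<open>i = j\<close> and \<open>h = 0\<close>,
  existence of the variances, i.e. square integrability of every component.\<close>

definition has_covariance_function ::
    "'w measure \<Rightarrow> (real ^ 'd \<Rightarrow> 'w \<Rightarrow> real ^ 'm) \<Rightarrow> (real ^ 'd \<Rightarrow> real ^ 'm ^ 'm) \<Rightarrow> bool" where
  "has_covariance_function M Z C \<longleftrightarrow>
     (\<forall>x i. square_integrable M (\<lambda>\<omega>. Z x \<omega> $ i)) \<and>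
     (\<forall>x h i j. covariance M (\<lambda>\<omega>. Z (x + h) \<omega> $ i) (\<lambda>\<omega>. Z x \<omega> $ j) = C h $ i $ j)"

definition second_order_stationary :: "'w measure \<Rightarrow> (real ^ 'd \<Rightarrow> 'w \<Rightarrow> real ^ 'm) \<Rightarrow> bool" where
  "second_order_stationary M Z \<longleftrightarrow>
     random_field M Z \<and>
     (\<exists>\<mu>. \<forall>x. prob_space.expectation M (Z x) = \<mu>) \<and>
     (\<exists>C. has_covariance_function M Z C)"

definition intrinsically_stationary :: "'w measure \<Rightarrow> (real ^ 'd \<Rightarrow> 'w \<Rightarrow> real ^ 'm) \<Rightarrow> bool" where
  "intrinsically_stationary M Z \<longleftrightarrow>
     random_field M Z \<and> (\<forall>h. second_order_stationary M (\<lambda>x \<omega>. Z (x + h) \<omega> - Z x \<omega>))"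

definition has_pseudo_variogram ::
    "'w measure \<Rightarrow> (real ^ 'd \<Rightarrow> 'w \<Rightarrow> real ^ 'm) \<Rightarrow> (real ^ 'd \<Rightarrow> real ^ 'm ^ 'm) \<Rightarrow> bool" where
  "has_pseudo_variogram M Z \<gamma> \<longleftrightarrow>
     intrinsically_stationary M Z \<and>
     (\<forall>x h i j. square_integrable M (\<lambda>\<omega>. Z (x + h) \<omega> $ i - Z x \<omega> $ j) \<and>
        \<gamma> h $ i $ j = 1 / 2 * prob_space.variance M (\<lambda>\<omega>. Z (x + h) \<omega> $ i - Z x \<omega> $ j))"

text \<open>A definition cannot quantify over the type of the sample space. The next two definitions use
  the path space \<open>real ^ 'd \<Rightarrow> real ^ 'm\<close> as sample space type, with an arbitrary \<open>\<sigma>\<close>-algebra and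
  probability measure on it. This loses nothing, since every field can be replaced by its law on
  path space: see \<open>is_pseudo_variogramI\<close> and \<open>matrix_correlation_functionI\<close>, where the sample space
  type is arbitrary.\<close>

definition is_pseudo_variogram :: "(real ^ 'd \<Rightarrow> real ^ 'm ^ 'm) \<Rightarrow> bool" where
  "is_pseudo_variogram \<gamma> \<longleftrightarrow>
     (\<exists>(M :: (real ^ 'd \<Rightarrow> real ^ 'm) measure) Z. has_pseudo_variogram M Z \<gamma>)"

definition matrix_correlation_function :: "(real ^ 'd \<Rightarrow> real ^ 'm ^ 'm) \<Rightarrow> bool" where
  "matrix_correlation_function C \<longleftrightarrow>
     (\<exists>(M :: (real ^ 'd \<Rightarrow> real ^ 'm) measure) Z.
        second_order_stationary M Z \<and> has_covariance_function M Z C) \<and>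
     (\<forall>i. C 0 $ i $ i = 1)"

definition exp_star :: "real ^ 'm ^ 'n \<Rightarrow> real ^ 'm ^ 'n" where
  "exp_star A = (\<chi> i j. exp (A $ i $ j))"

definition path_law ::
    "'w measure \<Rightarrow> (real ^ 'd \<Rightarrow> 'w \<Rightarrow> real ^ 'm) \<Rightarrow> (real ^ 'd \<Rightarrow> real ^ 'm) measure" where
  "path_law M Z = distr M (PiM UNIV (\<lambda>_. borel)) (\<lambda>\<omega> x. Z x \<omega>)"

lemma component_measurable:
  fixes T :: "'b \<Rightarrow> real ^ 'm"
  assumes "T \<in> borel_measurable N"
  shows "(\<lambda>f. T f $ i) \<in> borel_measurable N"
  by (rule measurable_compose[OF assms borel_measurable_continuous_onI]) (intro continuous_intros)

context
  fixes M :: "'w measure" and Z :: "real ^ 'd \<Rightarrow> 'w \<Rightarrow> real ^ 'm"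
  assumes field: "random_field M Z"
begin

lemma path_measurable: "(\<lambda>\<omega> x. Z x \<omega>) \<in> M \<rightarrow>\<^sub>M PiM UNIV (\<lambda>_. borel)"
  using field by (intro measurable_PiM_single') (auto simp: random_field_def)

lemma eval_measurable: "(\<lambda>f. f x) \<in> borel_measurable (PiM UNIV (\<lambda>_. borel :: (real ^ 'm) measure))"
  by measurable

lemma random_field_path_law:
  assumes "\<And>x. T x \<in> borel_measurable (PiM UNIV (\<lambda>_. borel))"
  shows "random_field (path_law M Z) T"
  using field assms
  by (auto simp: random_field_def path_law_def intro!: prob_space.prob_space_distr path_measurable)

lemma integral_path_law:
  fixes g :: "(real ^ 'd \<Rightarrow> real ^ 'm) \<Rightarrow> 'b::{banach, second_countable_topology}"
  assumes "g \<in> borel_measurable (PiM UNIV (\<lambda>_. borel))"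
  shows "integral\<^sup>L (path_law M Z) g = (\<integral>\<omega>. g (\<lambda>x. Z x \<omega>) \<partial>M)"
  unfolding path_law_def by (rule integral_distr[OF path_measurable assms])

lemma square_integrable_path_law:
  assumes g: "g \<in> borel_measurable (PiM UNIV (\<lambda>_. borel))"
    and s: "square_integrable M (\<lambda>\<omega>. g (\<lambda>x. Z x \<omega>))"
  shows "square_integrable (path_law M Z) g"
proof -
  have "(\<lambda>f. (g f)\<^sup>2) \<in> borel_measurable (PiM UNIV (\<lambda>_. borel))" using g by measurable
  from integrable_distr_eq[OF path_measurable this] show ?thesis
    using g s by (simp add: square_integrable_def path_law_def)
qed

lemma covariance_path_law:
  assumes [measurable]: "g \<in> borel_measurable (PiM UNIV (\<lambda>_. borel))"
      "k \<in> borel_measurable (PiM UNIV (\<lambda>_. borel))"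
  shows "covariance (path_law M Z) g k = covariance M (\<lambda>\<omega>. g (\<lambda>x. Z x \<omega>)) (\<lambda>\<omega>. k (\<lambda>x. Z x \<omega>))"
  unfolding covariance_def by (simp add: integral_path_law)

lemma has_covariance_function_path_law:
  assumes T: "\<And>x. T x \<in> borel_measurable (PiM UNIV (\<lambda>_. borel))"
    and c: "has_covariance_function M (\<lambda>x \<omega>. T x (\<lambda>y. Z y \<omega>)) C"
  shows "has_covariance_function (path_law M Z) T C"
proof -
  have Ti: "(\<lambda>f. T x f $ i) \<in> borel_measurable (PiM UNIV (\<lambda>_. borel))" for x i
    by (rule component_measurable[OF T])
  show ?thesis
    using c unfolding has_covariance_function_def
    by (auto simp: covariance_path_law[OF Ti Ti] intro!: square_integrable_path_law Ti)
qed

lemma second_order_stationary_path_law: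
  assumes T: "\<And>x. T x \<in> borel_measurable (PiM UNIV (\<lambda>_. borel))"
    and s: "second_order_stationary M (\<lambda>x \<omega>. T x (\<lambda>y. Z y \<omega>))"
  shows "second_order_stationary (path_law M Z) T"
  using s T unfolding second_order_stationary_def
  by (auto simp: integral_path_law intro: random_field_path_law has_covariance_function_path_law)

end

lemma is_pseudo_variogramI:
  fixes M :: "'w measure" and Z :: "real ^ 'd \<Rightarrow> 'w \<Rightarrow> real ^ 'm"
  assumes v: "has_pseudo_variogram M Z \<gamma>"
  shows "is_pseudo_variogram \<gamma>"
proof -
  let ?E = "\<lambda>x (f :: real ^ 'd \<Rightarrow> real ^ 'm). f x"
  have field: "random_field M Z"
    using v by (simp add: has_pseudo_variogram_def intrinsically_stationary_def)
  note ev [measurable] = eval_measurable[OF field]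
  have diff: "(\<lambda>f :: real ^ 'd \<Rightarrow> real ^ 'm. f (x + h) - f x) \<in> borel_measurable (PiM UNIV (\<lambda>_. borel))" for x h
    by (intro borel_measurable_diff ev)
  have comp: "(\<lambda>f :: real ^ 'd \<Rightarrow> real ^ 'm. f (x + h) $ i - f x $ j)
      \<in> borel_measurable (PiM UNIV (\<lambda>_. borel))" for x h i j
    by (intro borel_measurable_diff component_measurable ev)
  have "intrinsically_stationary (path_law M Z) ?E"
    using v unfolding has_pseudo_variogram_def intrinsically_stationary_def
    by (auto intro!: random_field_path_law[OF field] ev second_order_stationary_path_law[OF field] diff)
  then have "has_pseudo_variogram (path_law M Z) ?E \<gamma>"
    using v unfolding has_pseudo_variogram_def covariance_self[symmetric]
    by (simp add: covariance_path_law[OF field comp comp] square_integrable_path_law[OF field comp])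
  then show ?thesis unfolding is_pseudo_variogram_def by blast
qed

lemma matrix_correlation_functionI:
  fixes M :: "'w measure" and Z :: "real ^ 'd \<Rightarrow> 'w \<Rightarrow> real ^ 'm"
  assumes "second_order_stationary M Z" "has_covariance_function M Z C" "\<And>i. C 0 $ i $ i = 1"
  shows "matrix_correlation_function C"
proof -
  let ?E = "\<lambda>x (f :: real ^ 'd \<Rightarrow> real ^ 'm). f x"
  have field: "random_field M Z" using assms(1) by (simp add: second_order_stationary_def)
  note ev = eval_measurable[OF field]
  have "second_order_stationary (path_law M Z) ?E" "has_covariance_function (path_law M Z) ?E C"
    using assms by (auto intro!: second_order_stationary_path_law[OF field]
        has_covariance_function_path_law[OF field] ev)
  then show ?thesis unfolding matrix_correlation_function_def using assms(3) by blast
qed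

end

theory Submission
  imports Defs
begin

text \<open>
Regard an \<open>m\<close>-variate field on \<open>real ^ 'd\<close> as a scalar field indexed by pairs \<open>p = (x, i)\<close>, and write
\<open>D p q = \<gamma>\<^sub>i\<^sub>j(x - y)\<close> for \<open>p = (x, i)\<close>, \<open>q = (y, j)\<close>. Both sides of the equivalence become statements about
positive definite kernels on the set of pairs, by the fundamental existence theorem: every positive definite
kernel on an arbitrary set is the covariance of a centred square-integrable field
(\<open>pos_def_kernel_realizable\<close>), and conversely second moments form such a kernel
(\<open>pos_def_kernel_second_moments\<close>).

From left to right: if \<open>\<gamma>\<close> is the pseudo-variogram of \<open>Z\<close>, let \<open>V\<close> be the covariance of the differences of
\<open>Z\<close> with one fixed component at the origin. Then \<open>D p q = (V p p + V q q) / 2 - V p q\<close>, so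
\<open>exp (- t D p q) = f p * f q * exp (t V p q)\<close> with \<open>f p = exp (- t V p p / 2)\<close>. This is positive definite
because products (Schur) and limits of positive definite kernels are, whence the exponential series is
(\<open>pos_def_kernel_exp\<close>).

From right to left (Schoenberg's argument): for a fixed index \<open>s\<close> the Schur complement
\<open>exp (- t D p q) - exp (- t D p s) exp (- t D q s)\<close> is positive definite for every \<open>t > 0\<close>. Divided by \<open>t\<close>, it
tends to \<open>D p s + D q s - D p q\<close> as \<open>t\<close> decreases to \<open>0\<close> (\<open>pos_def_kernel_log_derivative\<close>). A field with this
covariance has pseudo-variogram \<open>\<gamma>\<close>.

The existence theorem is proved without Gaussian measures. Zorn's lemma, applied to a transfinite Gram--Schmidt
procedure, decomposes the kernel as \<open>K p q = \<Sum>b. \<phi>\<^sub>b(p) \<phi>\<^sub>b(q)\<close> (\<open>pos_def_kernel_decomposition\<close>). The field is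
\<open>\<Sum>b. \<phi>\<^sub>b(p) \<epsilon>\<^sub>b\<close> with independent random signs \<open>\<epsilon>\<^sub>b\<close>, where each variable is an \<open>L\<^sup>2\<close> limit of finite sums.
\<close>


section \<open>Positive definite kernels\<close>

definition pos_def_kernel :: "('a \<Rightarrow> 'a \<Rightarrow> real) \<Rightarrow> bool" where
  "pos_def_kernel K \<longleftrightarrow> (\<forall>p q. K p q = K q p) \<and>
     (\<forall>A c. finite A \<longrightarrow> 0 \<le> (\<Sum>p\<in>A. \<Sum>q\<in>A. c p * c q * K p q))"

lemma pos_def_kernelI:
  assumes "\<And>p q. K p q = K q p"
    and "\<And>A c. finite A \<Longrightarrow> 0 \<le> (\<Sum>p\<in>A. \<Sum>q\<in>A. c p * c q * K p q)"
  shows "pos_def_kernel K"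
  using assms unfolding pos_def_kernel_def by blast

lemma pos_def_kernel_sym: "pos_def_kernel K \<Longrightarrow> K p q = K q p"
  unfolding pos_def_kernel_def by blast

lemma pos_def_kernel_form_nonneg:
  "pos_def_kernel K \<Longrightarrow> finite A \<Longrightarrow> 0 \<le> (\<Sum>p\<in>A. \<Sum>q\<in>A. c p * c q * K p q)"
  unfolding pos_def_kernel_def by blast

lemma pos_def_kernel_diag: "pos_def_kernel K \<Longrightarrow> 0 \<le> K p p"
  using pos_def_kernel_form_nonneg[of K "{p}" "\<lambda>_. 1"] by simp

lemma pos_def_kernel_limit:
  assumes "F \<noteq> bot" "eventually (\<lambda>n. pos_def_kernel (K n)) F"
    and lim: "\<And>p q. ((\<lambda>n. K n p q) \<longlongrightarrow> L p q) F"
  shows "pos_def_kernel L"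
proof (rule pos_def_kernelI)
  fix p q
  have "((\<lambda>n. K n p q) \<longlongrightarrow> L q p) F"
    by (rule Lim_transform_eventually[OF lim])
      (use assms(2) in \<open>auto elim!: eventually_mono dest: pos_def_kernel_sym\<close>)
  then show "L p q = L q p" using tendsto_unique[OF assms(1) lim] by blast
next
  fix A :: "'b set" and c assume "finite A"
  show "0 \<le> (\<Sum>p\<in>A. \<Sum>q\<in>A. c p * c q * L p q)"
  proof (rule tendsto_lowerbound[OF _ _ assms(1)])
    show "((\<lambda>n. \<Sum>p\<in>A. \<Sum>q\<in>A. c p * c q * K n p q) \<longlongrightarrow> (\<Sum>p\<in>A. \<Sum>q\<in>A. c p * c q * L p q)) F"
      by (intro tendsto_intros lim)
    show "eventually (\<lambda>n. 0 \<le> (\<Sum>p\<in>A. \<Sum>q\<in>A. c p * c q * K n p q)) F"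
      using assms(2) by eventually_elim (rule pos_def_kernel_form_nonneg[OF _ \<open>finite A\<close>])
  qed
qed

lemma pos_def_kernel_rank_one: "pos_def_kernel (\<lambda>p q. f p * f q)"
proof (rule pos_def_kernelI)
  fix A :: "'a set" and c assume "finite A"
  have "(\<Sum>p\<in>A. \<Sum>q\<in>A. c p * c q * (f p * f q)) = (\<Sum>p\<in>A. c p * f p)\<^sup>2"
    unfolding power2_eq_square sum_product by (simp add: algebra_simps)
  then show "0 \<le> (\<Sum>p\<in>A. \<Sum>q\<in>A. c p * c q * (f p * f q))" by simp
qed simp

lemma pos_def_kernel_add:
  assumes "pos_def_kernel K" "pos_def_kernel L"
  shows "pos_def_kernel (\<lambda>p q. K p q + L p q)"
  using assms by (auto simp: pos_def_kernel_def distrib_left sum.distrib intro!: add_nonneg_nonneg)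

lemma pos_def_kernel_scale:
  assumes "pos_def_kernel K" "0 \<le> a"
  shows "pos_def_kernel (\<lambda>p q. a * K p q)"
proof (rule pos_def_kernelI)
  fix A :: "'a set" and c assume A: "finite A"
  have "(\<Sum>p\<in>A. \<Sum>q\<in>A. c p * c q * (a * K p q)) = a * (\<Sum>p\<in>A. \<Sum>q\<in>A. c p * c q * K p q)"
    by (simp add: sum_distrib_left mult_ac)
  with A show "0 \<le> (\<Sum>p\<in>A. \<Sum>q\<in>A. c p * c q * (a * K p q))"
    using pos_def_kernel_form_nonneg[OF assms(1) A] assms(2) by simp
qed (use pos_def_kernel_sym[OF assms(1)] in simp)

lemma pos_def_kernel_sum:
  assumes "\<And>b. b \<in> B \<Longrightarrow> pos_def_kernel (K b)"
  shows "pos_def_kernel (\<lambda>p q. \<Sum>b\<in>B. K b p q)"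
  using assms
proof (induction B rule: infinite_finite_induct)
  case (insert x F)
  then show ?case by (simp add: pos_def_kernel_add)
qed (use pos_def_kernel_rank_one[of "\<lambda>_. 0"] in simp_all)

lemma pos_def_kernel_congruence:
  assumes "pos_def_kernel K"
  shows "pos_def_kernel (\<lambda>p q. f p * f q * K p q)"
proof (rule pos_def_kernelI)
  fix A :: "'a set" and c assume "finite A"
  from pos_def_kernel_form_nonneg[OF assms this, of "\<lambda>p. c p * f p"]
  show "0 \<le> (\<Sum>p\<in>A. \<Sum>q\<in>A. c p * c q * (f p * f q * K p q))" by (simp add: mult_ac)
qed (use pos_def_kernel_sym[OF assms] in simp)

text \<open>The left-hand side is the quadratic form of \<open>K\<close> at \<open>c + z \<delta>\<^sub>s\<close>. Optimising over \<open>z\<close> gives both the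
Cauchy--Schwarz inequality and the positivity of the Schur complement.\<close>

lemma pos_def_kernel_shifted_form:
  assumes "pos_def_kernel K" "finite A"
  shows "0 \<le> (\<Sum>p\<in>A. \<Sum>q\<in>A. c p * c q * K p q) + 2 * z * (\<Sum>p\<in>A. c p * K p s) + z\<^sup>2 * K s s"
proof -
  \<comment> \<open>Enlarging the index set to contain \<open>s\<close> treats \<open>s \<in> A\<close> and \<open>s \<notin> A\<close> alike.\<close>
  define B where "B = insert s A"
  define c' where "c' p = (if p \<in> A then c p else 0)" for p
  define \<delta> where "\<delta> p = (if p = s then z else 0)" for p
  have B: "finite B" "s \<in> B" "A \<subseteq> B" using assms by (auto simp: B_def)
  have to_A: "(\<Sum>p\<in>B. c' p * g p) = (\<Sum>p\<in>A. c p * g p)" for g :: "_ \<Rightarrow> real"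
    by (rule sum.mono_neutral_cong_right) (use B in \<open>auto simp: c'_def\<close>)
  have at_s: "(\<Sum>p\<in>B. \<delta> p * g p) = z * g s" for g :: "_ \<Rightarrow> real"
    using B by (simp add: \<delta>_def if_distrib[of "\<lambda>x. x * _"] cong: if_cong)
  have "0 \<le> (\<Sum>p\<in>B. \<Sum>q\<in>B. (c' p + \<delta> p) * (c' q + \<delta> q) * K p q)"
    using pos_def_kernel_form_nonneg[OF assms(1) B(1)] .
  also have "\<dots> = (\<Sum>p\<in>B. c' p * (\<Sum>q\<in>B. c' q * K p q)) + (\<Sum>p\<in>B. c' p * (\<Sum>q\<in>B. \<delta> q * K p q))
      + (\<Sum>p\<in>B. \<delta> p * (\<Sum>q\<in>B. c' q * K p q)) + (\<Sum>p\<in>B. \<delta> p * (\<Sum>q\<in>B. \<delta> q * K p q))"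
    by (simp add: sum_distrib_left sum.distrib algebra_simps)
  also have "\<dots> = (\<Sum>p\<in>A. c p * (\<Sum>q\<in>A. c q * K p q)) + (\<Sum>p\<in>A. c p * (z * K p s))
      + z * (\<Sum>q\<in>A. c q * K s q) + z * (z * K s s)"
    by (simp only: to_A at_s)
  also have "(\<Sum>q\<in>A. c q * K s q) = (\<Sum>p\<in>A. c p * K p s)"
    by (simp add: pos_def_kernel_sym[OF assms(1), of s])
  finally show ?thesis
    by (simp add: sum_distrib_left mult_ac power2_eq_square)
qed

text \<open>The discriminant of a nonnegative quadratic polynomial in \<open>z\<close> is nonpositive; if \<open>K q q = 0\<close> the
polynomial is affine and its slope has to vanish.\<close>

lemma pos_def_kernel_Cauchy_Schwarz:
  assumes "pos_def_kernel K"
  shows "(K p q)\<^sup>2 \<le> K p p * K q q"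
proof -
  have form: "0 \<le> K p p + 2 * z * K p q + z\<^sup>2 * K q q" for z
    using pos_def_kernel_shifted_form[OF assms, of "{p}" "\<lambda>_. 1" z q] by simp
  show ?thesis
  proof (cases "K q q = 0")
    case True
    have "K p q = 0"
    proof (rule ccontr)
      assume "K p q \<noteq> 0"
      \<comment> \<open>the point at which the affine function takes the value \<open>-1\<close>\<close>
      then have "2 * (- (K p p + 1) / (2 * K p q)) * K p q = - (K p p + 1)" by simp
      with form[of "- (K p p + 1) / (2 * K p q)"] True show False by simp
    qed
    with True show ?thesis by simp
  next
    case False
    then have "K q q > 0" using pos_def_kernel_diag[OF assms, of q] by simp
    with form[of "- K p q / K q q"] show ?thesis
      by (simp add: power2_eq_square field_simps)
  qed
qed

text \<open>The Schur complement: if \<open>K\<close> is the covariance of \<open>X\<close>, this is the covariance of what remains of \<open>X\<close>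
after subtracting its projection onto \<open>X\<^sub>s\<close>. The choice \<open>z = - u / K s s\<close> in the shifted form
is the minimiser.\<close>

lemma pos_def_kernel_deflate:
  assumes "pos_def_kernel K" "K s s > 0"
  shows "pos_def_kernel (\<lambda>p q. K p q - K p s * K q s / K s s)"
proof (rule pos_def_kernelI)
  fix A :: "'a set" and c assume A: "finite A"
  define u where "u = (\<Sum>p\<in>A. c p * K p s)"
  have "u\<^sup>2 = (\<Sum>p\<in>A. \<Sum>q\<in>A. c p * K p s * (c q * K q s))"
    by (simp add: u_def power2_eq_square sum_product)
  then have "(\<Sum>p\<in>A. \<Sum>q\<in>A. c p * c q * (K p q - K p s * K q s / K s s))
      = (\<Sum>p\<in>A. \<Sum>q\<in>A. c p * c q * K p q) - u\<^sup>2 / K s s"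
    by (simp add: sum_divide_distrib sum_subtractf right_diff_distrib mult_ac)
  also have "\<dots> = (\<Sum>p\<in>A. \<Sum>q\<in>A. c p * c q * K p q) + 2 * (- u / K s s) * u + (- u / K s s)\<^sup>2 * K s s"
    using assms(2) by (simp add: power2_eq_square field_simps)
  also have "\<dots> \<ge> 0"
    using pos_def_kernel_shifted_form[OF assms(1) A, of c "- u / K s s" s] by (simp add: u_def)
  finally show "0 \<le> (\<Sum>p\<in>A. \<Sum>q\<in>A. c p * c q * (K p q - K p s * K q s / K s s))" .
qed (use pos_def_kernel_sym[OF assms(1)] in \<open>simp add: mult.commute\<close>)

section \<open>Decomposition into rank-one kernels\<close>

text \<open>Functions carry a tag of type \<open>nat\<close> so that the same function may be subtracted several times
although the collection is a set.\<close>

definition residual :: "('a \<Rightarrow> 'a \<Rightarrow> real) \<Rightarrow> (nat \<times> ('a \<Rightarrow> real)) set \<Rightarrow> 'a \<Rightarrow> 'a \<Rightarrow> real" where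
  "residual K G p q = K p q - (\<Sum>b\<in>G. snd b p * snd b q)"

text \<open>A property of finite character, hence amenable to Zorn's lemma. In the reproducing kernel Hilbert
space of \<open>K\<close> a subordinate set is a family with \<open>\<Sum>b. \<phi>\<^sub>b \<otimes> \<phi>\<^sub>b \<le> id\<close>.\<close>

definition subordinate :: "('a \<Rightarrow> 'a \<Rightarrow> real) \<Rightarrow> (nat \<times> ('a \<Rightarrow> real)) set \<Rightarrow> bool" where
  "subordinate K F \<longleftrightarrow> (\<forall>G. finite G \<longrightarrow> G \<subseteq> F \<longrightarrow> pos_def_kernel (residual K G))"

lemma subordinate_maximal_exists:
  assumes "pos_def_kernel K"
  obtains F where "subordinate K F" "\<And>F'. subordinate K F' \<Longrightarrow> F \<subseteq> F' \<Longrightarrow> F' = F"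
proof -
  have "\<exists>F\<in>Collect (subordinate K). \<forall>F'\<in>Collect (subordinate K). F \<subseteq> F' \<longrightarrow> F' = F"
  proof (rule subset_Zorn_nonempty)
    have "subordinate K {}" using assms by (simp add: subordinate_def residual_def[abs_def])
    then show "Collect (subordinate K) \<noteq> {}" by auto
    fix \<C> assume ne: "\<C> \<noteq> {}" and ch: "subset.chain (Collect (subordinate K)) \<C>"
    have "pos_def_kernel (residual K G)" if G: "finite G" "G \<subseteq> \<Union>\<C>" for G
    proof -
      obtain F where "F \<in> \<C>" "G \<subseteq> F" using finite_subset_Union_chain[OF G ne ch] by blast
      moreover have "subordinate K F" using ch \<open>F \<in> \<C>\<close> by (auto simp: subset.chain_def)
      ultimately show ?thesis using G by (auto simp: subordinate_def)
    qed
    then show "\<Union>\<C> \<in> Collect (subordinate K)" by (simp add: subordinate_def)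
  qed
  then show ?thesis using that by blast
qed

lemma subordinate_sum_le:
  assumes "subordinate K F" "finite G" "G \<subseteq> F"
  shows "(\<Sum>b\<in>G. (snd b p)\<^sup>2) \<le> K p p"
  using pos_def_kernel_diag[of "residual K G" p] assms
  by (auto simp: subordinate_def residual_def power2_eq_square)

lemma subordinate_summable:
  assumes "subordinate K F"
  shows "(\<lambda>b. snd b p * snd b q) summable_on F"
proof -
  have sq: "(\<lambda>b. norm (snd b r * snd b r)) summable_on F" for r
    by (rule nonneg_bdd_above_summable_on)
      (use subordinate_sum_le[OF assms] in \<open>auto simp: power2_eq_square bdd_above_def abs_mult\<close>)
  show ?thesis by (rule abs_summable_summable[OF abs_summable_product[OF sq sq]])
qed

text \<open>As long as the limiting residual \<open>R\<close> is nonzero at some \<open>(s, s)\<close>, one more Gram--Schmidt step is possible: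
subtract the rank-one kernel of \<open>\<phi> = R(\<cdot>, s) / sqrt (R s s)\<close>, which leaves the Schur complement of \<open>R\<close>.
Since \<open>R\<close> is smaller than every finite residual by a positive definite kernel, the enlarged set is again
subordinate.\<close>

lemma subordinate_extend:
  fixes K :: "'a \<Rightarrow> 'a \<Rightarrow> real" and F :: "(nat \<times> ('a \<Rightarrow> real)) set"
  defines "R \<equiv> \<lambda>p q. K p q - infsum (\<lambda>b. snd b p * snd b q) F"
  assumes F: "subordinate K F" and pos: "R s s \<noteq> 0"
  obtains b where "b \<notin> F" "subordinate K (insert b F)"
proof -
  have lim: "((\<lambda>G. \<Sum>b\<in>G. snd b p * snd b q) \<longlongrightarrow> infsum (\<lambda>b. snd b p * snd b q) F)
      (finite_subsets_at_top F)" for p q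
    using has_sum_infsum[OF subordinate_summable[OF F]] by (simp add: has_sum_def)
  have PD_R: "pos_def_kernel R"
  proof (rule pos_def_kernel_limit[of "finite_subsets_at_top F"])
    show "eventually (\<lambda>G. pos_def_kernel (residual K G)) (finite_subsets_at_top F)"
      using F by (intro eventually_finite_subsets_at_top_weakI) (auto simp: subordinate_def)
    show "((\<lambda>G. residual K G p q) \<longlongrightarrow> R p q) (finite_subsets_at_top F)" for p q
      unfolding residual_def R_def by (intro tendsto_intros lim)
  qed simp
  have R_pos: "R s s > 0" using pos pos_def_kernel_diag[OF PD_R, of s] by simp
  define \<phi> where "\<phi> p = R p s / sqrt (R s s)" for p
  have \<phi>\<phi>: "\<phi> p * \<phi> q = R p s * R q s / R s s" for p q
    using R_pos by (simp add: \<phi>_def)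
  have PD_R': "pos_def_kernel (\<lambda>p q. R p q - \<phi> p * \<phi> q)"
    unfolding \<phi>\<phi> by (rule pos_def_kernel_deflate[OF PD_R R_pos])
  have \<phi>_pos: "(\<phi> s)\<^sup>2 > 0" using R_pos by (simp add: power2_eq_square \<phi>\<phi>)
  \<comment> \<open>A fresh tag exists because \<open>K s s\<close> bounds the number of copies of \<open>\<phi>\<close> that were subtracted.\<close>
  have "\<exists>n. (n, \<phi>) \<notin> F"
  proof (rule ccontr)
    assume all: "\<nexists>n. (n, \<phi>) \<notin> F"
    obtain N :: nat where N: "K s s < of_nat N * (\<phi> s)\<^sup>2"
      using reals_Archimedean3[OF \<phi>_pos] by blast
    have "(\<Sum>b\<in>{..<N} \<times> {\<phi>}. (snd b s)\<^sup>2) \<le> K s s"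
      using all by (intro subordinate_sum_le[OF F]) auto
    moreover have "(\<Sum>b\<in>{..<N} \<times> {\<phi>}. (snd b s)\<^sup>2) = of_nat N * (\<phi> s)\<^sup>2"
      by (subst sum.cartesian_product[symmetric, of "\<lambda>_ f. (f s)\<^sup>2", simplified split_def]) simp
    ultimately show False using N by simp
  qed
  then obtain n where n: "(n, \<phi>) \<notin> F" by blast
  have "subordinate K (insert (n, \<phi>) F)"
    unfolding subordinate_def
  proof (intro allI impI)
    fix G assume G: "finite G" "G \<subseteq> insert (n, \<phi>) F"
    show "pos_def_kernel (residual K G)"
    proof (cases "(n, \<phi>) \<in> G")
      case False
      with G F show ?thesis by (auto simp: subordinate_def)
    next
      case True
      define G0 where "G0 = G - {(n, \<phi>)}"
      have G0: "finite G0" "G0 \<subseteq> F" "G = insert (n, \<phi>) G0" "(n, \<phi>) \<notin> G0"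
        using G True by (auto simp: G0_def)
      \<comment> \<open>\<open>T\<close> is the part of the full sum over \<open>F\<close> outside \<open>G0\<close>, a limit of finite sums of rank-one kernels.\<close>
      define T where "T p q = infsum (\<lambda>b. snd b p * snd b q) F - (\<Sum>b\<in>G0. snd b p * snd b q)" for p q
      have "pos_def_kernel T"
      proof (rule pos_def_kernel_limit[of "finite_subsets_at_top F"])
        show "((\<lambda>H. (\<Sum>b\<in>H. snd b p * snd b q) - (\<Sum>b\<in>G0. snd b p * snd b q)) \<longlongrightarrow> T p q)
            (finite_subsets_at_top F)" for p q
          unfolding T_def by (intro tendsto_intros lim)
        have "pos_def_kernel (\<lambda>p q. (\<Sum>b\<in>H. snd b p * snd b q) - (\<Sum>b\<in>G0. snd b p * snd b q))"
          if "finite H" "G0 \<subseteq> H" for H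
          using that by (simp add: sum_diff[symmetric] pos_def_kernel_sum pos_def_kernel_rank_one)
        then show "eventually (\<lambda>H. pos_def_kernel (\<lambda>p q. (\<Sum>b\<in>H. snd b p * snd b q) - (\<Sum>b\<in>G0. snd b p * snd b q)))
            (finite_subsets_at_top F)"
          unfolding eventually_finite_subsets_at_top using G0 by blast
      qed simp
      moreover have "residual K G = (\<lambda>p q. (R p q - \<phi> p * \<phi> q) + T p q)"
        using G0 by (auto simp: residual_def R_def T_def fun_eq_iff)
      ultimately show ?thesis using pos_def_kernel_add[OF PD_R'] by simp
    qed
  qed
  with n show ?thesis using that by blast
qed

text \<open>A maximal subordinate set exhausts \<open>K\<close>: it is a (possibly uncountable) Parseval frame of the reproducing
kernel Hilbert space, obtained without constructing that space.\<close>

theorem pos_def_kernel_decomposition: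
  assumes "pos_def_kernel K"
  obtains F where "subordinate K F" "\<And>p. ((\<lambda>b. (snd b p)\<^sup>2) has_sum K p p) F"
proof -
  obtain F where F: "subordinate K F" and max: "\<And>F'. subordinate K F' \<Longrightarrow> F \<subseteq> F' \<Longrightarrow> F' = F"
    using subordinate_maximal_exists[OF assms] by blast
  have "K p p = infsum (\<lambda>b. snd b p * snd b p) F" for p
    using subordinate_extend[OF F, of p] max by (metis eq_iff_diff_eq_0 insertI1 subset_insertI)
  then have "((\<lambda>b. (snd b p)\<^sup>2) has_sum K p p) F" for p
    using has_sum_infsum[OF subordinate_summable[OF F, of p p]] by (simp add: power2_eq_square)
  with F that show ?thesis by blast
qed


section \<open>Square-integrable variables and their second moments\<close>

lemma square_integrable_mult:
  assumes "square_integrable M X" "square_integrable M Y"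
  shows "integrable M (\<lambda>\<omega>. X \<omega> * Y \<omega>)"
proof (rule Bochner_Integration.integrable_bound)
  show "integrable M (\<lambda>\<omega>. (X \<omega>)\<^sup>2 + (Y \<omega>)\<^sup>2)"
    using assms by (simp add: square_integrable_def)
  show "(\<lambda>\<omega>. X \<omega> * Y \<omega>) \<in> borel_measurable M"
    using assms by (auto simp: square_integrable_def)
  have "\<bar>x * y\<bar> \<le> x\<^sup>2 + y\<^sup>2" for x y :: real
  proof -
    have "2 * \<bar>x * y\<bar> \<le> x\<^sup>2 + y\<^sup>2" using sum_squares_bound[of "\<bar>x\<bar>" "\<bar>y\<bar>"] by (simp add: abs_mult)
    then show ?thesis using abs_ge_zero[of "x * y"] by linarith
  qed
  then show "AE \<omega> in M. norm (X \<omega> * Y \<omega>) \<le> norm ((X \<omega>)\<^sup>2 + (Y \<omega>)\<^sup>2)" by simp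
qed

lemma square_integrable_cmult:
  assumes "square_integrable M X"
  shows "square_integrable M (\<lambda>\<omega>. a * X \<omega>)"
  using assms by (auto simp: square_integrable_def power_mult_distrib)

lemma square_integrable_add:
  assumes "square_integrable M X" "square_integrable M Y"
  shows "square_integrable M (\<lambda>\<omega>. X \<omega> + Y \<omega>)"
  using assms square_integrable_mult[OF assms]
  by (auto simp: square_integrable_def power2_sum mult.assoc)

lemma square_integrable_diff:
  assumes "square_integrable M X" "square_integrable M Y"
  shows "square_integrable M (\<lambda>\<omega>. X \<omega> - Y \<omega>)"
  using square_integrable_add[OF assms(1) square_integrable_cmult[OF assms(2), of "-1"]] by simp

lemma square_integrable_sum:
  assumes "\<And>b. b \<in> B \<Longrightarrow> square_integrable M (X b)"
  shows "square_integrable M (\<lambda>\<omega>. \<Sum>b\<in>B. X b \<omega>)"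
  using assms
proof (induction B rule: infinite_finite_induct)
  case (insert x F)
  then show ?case by (simp add: square_integrable_add)
qed (simp_all add: square_integrable_def)

lemma pos_def_kernel_second_moments:
  assumes "\<And>p. square_integrable M (X p)"
  shows "pos_def_kernel (\<lambda>p q. \<integral>\<omega>. X p \<omega> * X q \<omega> \<partial>M)"
proof (rule pos_def_kernelI)
  fix A :: "'a set" and c assume "finite A"
  have int: "integrable M (\<lambda>\<omega>. X p \<omega> * X q \<omega>)" for p q
    by (rule square_integrable_mult[OF assms assms])
  have "(\<Sum>p\<in>A. \<Sum>q\<in>A. c p * c q * (\<integral>\<omega>. X p \<omega> * X q \<omega> \<partial>M))
      = (\<integral>\<omega>. (\<Sum>p\<in>A. \<Sum>q\<in>A. c p * c q * (X p \<omega> * X q \<omega>)) \<partial>M)"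
    using int by simp
  also have "\<dots> = (\<integral>\<omega>. (\<Sum>p\<in>A. c p * X p \<omega>)\<^sup>2 \<partial>M)"
    by (simp add: power2_eq_square sum_product mult_ac)
  also have "\<dots> \<ge> 0" by simp
  finally show "0 \<le> (\<Sum>p\<in>A. \<Sum>q\<in>A. c p * c q * (\<integral>\<omega>. X p \<omega> * X q \<omega> \<partial>M))" .
qed (simp add: mult.commute)

text \<open>The Cauchy--Schwarz inequality for kernels, applied to the second-moment kernel of a two-element family.\<close>

lemma integral_mult_Cauchy_Schwarz:
  assumes "square_integrable M U" "square_integrable M V"
  shows "(\<integral>\<omega>. U \<omega> * V \<omega> \<partial>M)\<^sup>2 \<le> (\<integral>\<omega>. (U \<omega>)\<^sup>2 \<partial>M) * (\<integral>\<omega>. (V \<omega>)\<^sup>2 \<partial>M)"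
proof -
  have "pos_def_kernel (\<lambda>p q. \<integral>\<omega>. (if p then U else V) \<omega> * (if q then U else V) \<omega> \<partial>M)"
    using assms by (intro pos_def_kernel_second_moments) auto
  from pos_def_kernel_Cauchy_Schwarz[OF this, of True False] show ?thesis
    by (simp add: power2_eq_square)
qed

text \<open>The rate \<open>(1 / 4) ^ k\<close> for squares is the one at which all \<open>L\<^sup>2\<close> approximations below converge.\<close>

lemma tendsto_of_power2_le:
  fixes x :: "nat \<Rightarrow> real"
  assumes le: "\<And>k. (x k - a)\<^sup>2 \<le> C * (1 / 4) ^ k"
  shows "x \<longlonglongrightarrow> a"
proof -
  have "(\<lambda>k. (x k - a)\<^sup>2) \<longlonglongrightarrow> 0"
  proof (rule tendsto_sandwich[of "\<lambda>_. 0"])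
    show "(\<lambda>k. C * (1 / 4) ^ k) \<longlonglongrightarrow> 0"
      by (rule tendsto_mult_right_zero, rule LIMSEQ_realpow_zero) auto
  qed (use le in auto)
  then have "(\<lambda>k. sqrt ((x k - a)\<^sup>2)) \<longlonglongrightarrow> sqrt 0" by (rule tendsto_real_sqrt)
  then show ?thesis by (simp add: tendsto_rabs_zero_iff LIM_zero_iff)
qed

lemma L2_limit_integral_mult:
  assumes f: "\<And>k. square_integrable M (f k)" and h: "square_integrable M h"
    and g: "square_integrable M g"
    and le: "\<And>k. (\<integral>\<omega>. (h \<omega> - f k \<omega>)\<^sup>2 \<partial>M) \<le> (1 / 4) ^ k"
  shows "(\<lambda>k. \<integral>\<omega>. f k \<omega> * g \<omega> \<partial>M) \<longlonglongrightarrow> (\<integral>\<omega>. h \<omega> * g \<omega> \<partial>M)"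
proof (rule tendsto_of_power2_le)
  fix k
  have "(\<integral>\<omega>. f k \<omega> * g \<omega> \<partial>M) - (\<integral>\<omega>. h \<omega> * g \<omega> \<partial>M) = - (\<integral>\<omega>. (h \<omega> - f k \<omega>) * g \<omega> \<partial>M)"
    using square_integrable_mult[OF f g] square_integrable_mult[OF h g] by (simp add: left_diff_distrib)
  then have "((\<integral>\<omega>. f k \<omega> * g \<omega> \<partial>M) - (\<integral>\<omega>. h \<omega> * g \<omega> \<partial>M))\<^sup>2 \<le>
      (\<integral>\<omega>. (h \<omega> - f k \<omega>)\<^sup>2 \<partial>M) * (\<integral>\<omega>. (g \<omega>)\<^sup>2 \<partial>M)"
    using integral_mult_Cauchy_Schwarz[OF square_integrable_diff[OF h f] g] by simp
  also have "\<dots> \<le> (1 / 4) ^ k * (\<integral>\<omega>. (g \<omega>)\<^sup>2 \<partial>M)"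
    by (intro mult_right_mono le) simp
  finally show "((\<integral>\<omega>. f k \<omega> * g \<omega> \<partial>M) - (\<integral>\<omega>. h \<omega> * g \<omega> \<partial>M))\<^sup>2 \<le> (\<integral>\<omega>. (g \<omega>)\<^sup>2 \<partial>M) * (1 / 4) ^ k"
    by (simp add: mult.commute)
qed

text \<open>Riesz--Fischer for rapidly convergent sequences. The increments have \<open>L\<^sup>1\<close> norm at most \<open>(1 / 2) ^ k\<close>, so the
sequence converges almost surely; Fatou's lemma transfers the bounds on \<open>f j - f k\<close> to the limit \<open>j \<longrightarrow> \<infinity>\<close>.\<close>

lemma (in prob_space) L2_complete:
  assumes f: "\<And>k. square_integrable M (f k)"
    and cauchy: "\<And>k j. k \<le> j \<Longrightarrow> (\<integral>\<omega>. (f j \<omega> - f k \<omega>)\<^sup>2 \<partial>M) \<le> (1 / 4) ^ k"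
  obtains h where "square_integrable M h" "\<And>k. (\<integral>\<omega>. (h \<omega> - f k \<omega>)\<^sup>2 \<partial>M) \<le> (1 / 4) ^ k"
proof -
  have [measurable]: "f k \<in> borel_measurable M" for k using f by (simp add: square_integrable_def)
  have sq: "integrable M (\<lambda>\<omega>. (f j \<omega> - f k \<omega>)\<^sup>2)" for j k
    using square_integrable_diff[OF f f] by (simp add: square_integrable_def)
  define u where "u k \<omega> = f (Suc k) \<omega> - f k \<omega>" for k \<omega>
  have [measurable]: "u k \<in> borel_measurable M" for k by (simp add: u_def[abs_def])
  have u_L1: "(\<integral>\<^sup>+\<omega>. ennreal \<bar>u k \<omega>\<bar> \<partial>M) \<le> ennreal ((1 / 2) ^ k)" for k
  proof -
    \<comment> \<open>arithmetic and geometric mean with the weight that balances \<open>x\<^sup>2\<close> of size \<open>(1 / 4) ^ k\<close>\<close>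
    have "\<bar>x\<bar> \<le> (2 ^ k * x\<^sup>2 + (1 / 2) ^ k) / 2" for x :: real
    proof -
      have "0 \<le> 2 ^ k * (\<bar>x\<bar> - (1 / 2) ^ k)\<^sup>2" by simp
      also have "\<dots> = 2 ^ k * x\<^sup>2 - 2 * \<bar>x\<bar> + (1 / 2) ^ k"
        by (simp add: power2_diff algebra_simps power_divide) (simp add: power2_eq_square)
      finally show ?thesis by simp
    qed
    then have "(\<integral>\<^sup>+\<omega>. ennreal \<bar>u k \<omega>\<bar> \<partial>M) \<le> (\<integral>\<^sup>+\<omega>. ennreal ((2 ^ k * (u k \<omega>)\<^sup>2 + (1 / 2) ^ k) / 2) \<partial>M)"
      by (intro nn_integral_mono ennreal_leI) simp
    also have "\<dots> = ennreal (\<integral>\<omega>. (2 ^ k * (u k \<omega>)\<^sup>2 + (1 / 2) ^ k) / 2 \<partial>M)"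
      using sq[of "Suc k" k] by (intro nn_integral_eq_integral) (auto simp: u_def)
    also have "(\<integral>\<omega>. (2 ^ k * (u k \<omega>)\<^sup>2 + (1 / 2) ^ k) / 2 \<partial>M)
        = (2 ^ k * (\<integral>\<omega>. (u k \<omega>)\<^sup>2 \<partial>M) + (1 / 2) ^ k) / 2"
      using sq[of "Suc k" k] by (simp add: u_def prob_space)
    also have "\<dots> \<le> (2 ^ k * (1 / 4) ^ k + (1 / 2) ^ k) / 2"
      using cauchy[of k "Suc k"] by (simp add: u_def)
    also have "(2 :: real) ^ k * (1 / 4) ^ k = (1 / 2) ^ k"
      by (simp add: power_mult_distrib[symmetric])
    finally show ?thesis by (simp add: ennreal_leI)
  qed
  have "(\<integral>\<^sup>+\<omega>. (\<Sum>k. ennreal \<bar>u k \<omega>\<bar>) \<partial>M) = (\<Sum>k. \<integral>\<^sup>+\<omega>. ennreal \<bar>u k \<omega>\<bar> \<partial>M)"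
    by (rule nn_integral_suminf) simp
  also have "\<dots> \<le> (\<Sum>k. ennreal ((1 / 2) ^ k))"
    by (intro suminf_le u_L1) auto
  also have "\<dots> < \<infinity>"
    unfolding infinity_ennreal_def
    by (intro less_top[THEN iffD1] ennreal_suminf_neq_top summable_geometric) simp_all
  finally have "AE \<omega> in M. (\<Sum>k. ennreal \<bar>u k \<omega>\<bar>) \<noteq> \<infinity>"
    by (intro nn_integral_PInf_AE) auto
  then have conv: "AE \<omega> in M. summable (\<lambda>k. u k \<omega>)"
  proof eventually_elim
    case (elim \<omega>)
    then have "summable (\<lambda>k. \<bar>u k \<omega>\<bar>)" by (intro summable_suminf_not_top) simp_all
    then show ?case by (rule summable_rabs_cancel)
  qed
  define h where "h \<omega> = f 0 \<omega> + (\<Sum>k. u k \<omega>)" for \<omega>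
  have [measurable]: "h \<in> borel_measurable M" by (simp add: h_def[abs_def])
  have lim: "AE \<omega> in M. (\<lambda>j. f j \<omega>) \<longlonglongrightarrow> h \<omega>"
    using conv
  proof eventually_elim
    case (elim \<omega>)
    have "(\<lambda>j. f 0 \<omega> + (\<Sum>k<j. u k \<omega>)) \<longlonglongrightarrow> h \<omega>"
      unfolding h_def by (intro tendsto_intros summable_LIMSEQ elim)
    moreover have "f 0 \<omega> + (\<Sum>k<j. u k \<omega>) = f j \<omega>" for j
      using sum_lessThan_telescope[of "\<lambda>k. f k \<omega>" j] by (simp add: u_def)
    ultimately show ?case by simp
  qed
  have fatou: "(\<integral>\<^sup>+\<omega>. ennreal ((h \<omega> - f k \<omega>)\<^sup>2) \<partial>M) \<le> ennreal ((1 / 4) ^ k)" for k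
  proof -
    have "AE \<omega> in M. ennreal ((h \<omega> - f k \<omega>)\<^sup>2) = liminf (\<lambda>j. ennreal ((f j \<omega> - f k \<omega>)\<^sup>2))"
      using lim
    proof eventually_elim
      case (elim \<omega>)
      have "(\<lambda>j. ennreal ((f j \<omega> - f k \<omega>)\<^sup>2)) \<longlonglongrightarrow> ennreal ((h \<omega> - f k \<omega>)\<^sup>2)"
        by (intro tendsto_intros elim tendsto_ennrealI)
      from lim_imp_Liminf[OF _ this] show ?case by simp
    qed
    then have "(\<integral>\<^sup>+\<omega>. ennreal ((h \<omega> - f k \<omega>)\<^sup>2) \<partial>M)
        = (\<integral>\<^sup>+\<omega>. liminf (\<lambda>j. ennreal ((f j \<omega> - f k \<omega>)\<^sup>2)) \<partial>M)"
      by (rule nn_integral_cong_AE)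
    also have "\<dots> \<le> liminf (\<lambda>j. \<integral>\<^sup>+\<omega>. ennreal ((f j \<omega> - f k \<omega>)\<^sup>2) \<partial>M)"
      by (rule nn_integral_liminf) simp
    also have "\<dots> \<le> ennreal ((1 / 4) ^ k)"
    proof (rule Liminf_le)
      show "\<forall>\<^sub>F j in sequentially. (\<integral>\<^sup>+\<omega>. ennreal ((f j \<omega> - f k \<omega>)\<^sup>2) \<partial>M) \<le> ennreal ((1 / 4) ^ k)"
        using eventually_ge_at_top[of k]
      proof eventually_elim
        case (elim j)
        have "(\<integral>\<^sup>+\<omega>. ennreal ((f j \<omega> - f k \<omega>)\<^sup>2) \<partial>M) = ennreal (\<integral>\<omega>. (f j \<omega> - f k \<omega>)\<^sup>2 \<partial>M)"
          by (intro nn_integral_eq_integral sq) simp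
        then show ?case using cauchy[OF elim] by (simp add: ennreal_leI)
      qed
    qed simp
    finally show ?thesis .
  qed
  have h_sq: "integrable M (\<lambda>\<omega>. (h \<omega> - f k \<omega>)\<^sup>2)" for k
    using fatou[of k] by (intro integrableI_bounded) (auto intro: le_less_trans)
  have "square_integrable M (\<lambda>\<omega>. (h \<omega> - f 0 \<omega>) + f 0 \<omega>)"
    using h_sq by (intro square_integrable_add f) (simp add: square_integrable_def)
  moreover have "(\<integral>\<omega>. (h \<omega> - f k \<omega>)\<^sup>2 \<partial>M) \<le> (1 / 4) ^ k" for k
    using fatou[of k] nn_integral_eq_integral[OF h_sq[of k]] by simp
  ultimately show ?thesis using that[of h] by simp
qed

section \<open>Random fields with prescribed covariance\<close>

text \<open>Fair coin tosses indexed by an arbitrary type. Products over nonempty finite index sets have expectation \<open>0\<close>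
because the finite-dimensional marginals of the product measure are product measures.\<close>

lemma independent_signs_exist:
  obtains M :: "('b \<Rightarrow> bool) measure" and \<epsilon> :: "'b \<Rightarrow> ('b \<Rightarrow> bool) \<Rightarrow> real"
  where "prob_space M" "\<And>b. square_integrable M (\<epsilon> b)" "\<And>b. (\<integral>\<omega>. \<epsilon> b \<omega> \<partial>M) = 0"
    "\<And>b c. (\<integral>\<omega>. \<epsilon> b \<omega> * \<epsilon> c \<omega> \<partial>M) = (if b = c then 1 else 0)"
proof -
  define N where "N = (\<lambda>_ :: 'b. measure_pmf (bernoulli_pmf (1 / 2)))"
  define sg :: "bool \<Rightarrow> real" where "sg x = (if x then 1 else - 1)" for x
  define M where "M = PiM UNIV N"
  interpret N: product_prob_space N UNIV
    unfolding N_def by (rule product_prob_spaceI) (rule measure_pmf.prob_space_axioms)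
  interpret P: prob_space M unfolding M_def by (rule prob_space_PiM) (simp add: N_def measure_pmf.prob_space_axioms)
  define \<epsilon> where "\<epsilon> b \<omega> = sg (\<omega> b)" for b :: 'b and \<omega>
  have [measurable]: "\<epsilon> b \<in> borel_measurable M" for b
    unfolding \<epsilon>_def[abs_def] M_def N_def by measurable
  have sq: "square_integrable M (\<epsilon> b)" for b
    unfolding square_integrable_def
  proof
    show "integrable M (\<lambda>\<omega>. (\<epsilon> b \<omega>)\<^sup>2)"
    proof (rule P.integrable_const_bound[where B=1])
      show "AE \<omega> in M. norm ((\<epsilon> b \<omega>)\<^sup>2) \<le> 1" by (simp add: \<epsilon>_def sg_def)
    qed simp
  qed simp
  have prod: "(\<integral>\<omega>. (\<Prod>b\<in>J. \<epsilon> b \<omega>) \<partial>M) = (\<Prod>b\<in>J. 0)" if J: "finite J" for J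
  proof -
    have "(\<Prod>b\<in>J. \<epsilon> b \<omega>) = (\<Prod>b\<in>J. sg (restrict \<omega> J b))" for \<omega>
      by (rule prod.cong) (simp_all add: \<epsilon>_def)
    then have "(\<integral>\<omega>. (\<Prod>b\<in>J. \<epsilon> b \<omega>) \<partial>M) = (\<integral>\<omega>. (\<Prod>b\<in>J. sg (restrict \<omega> J b)) \<partial>M)"
      by simp
    \<comment> \<open>Only finitely many coordinates occur, so the integral can be moved to a finite product.\<close>
    also have "\<dots> = (\<integral>x. (\<Prod>b\<in>J. sg (x b)) \<partial>distr M (PiM J N) (\<lambda>\<omega>. restrict \<omega> J))"
      unfolding M_def N_def
      by (intro integral_distr[symmetric] measurable_restrict_subset) (auto intro!: borel_measurable_prod)
    also have "distr M (PiM J N) (\<lambda>\<omega>. restrict \<omega> J) = PiM J N"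
      unfolding M_def by (rule N.distr_PiM_restrict_finite) (use J in auto)
    also have "(\<integral>x. (\<Prod>b\<in>J. sg (x b)) \<partial>PiM J N) = (\<Prod>b\<in>J. integral\<^sup>L (N b) sg)"
      by (rule N.product_integral_prod[OF J])
        (auto simp: N_def sg_def intro!: measure_pmf.integrable_const_bound[where B=1])
    also have "\<dots> = (\<Prod>b\<in>J. 0)"
      by (simp add: N_def sg_def)
    finally show ?thesis .
  qed
  have "(\<integral>\<omega>. \<epsilon> b \<omega> * \<epsilon> c \<omega> \<partial>M) = (if b = c then 1 else 0)" for b c
  proof (cases "b = c")
    case True
    have "\<epsilon> b \<omega> * \<epsilon> b \<omega> = 1" for \<omega> by (simp add: \<epsilon>_def sg_def)
    with True show ?thesis by (simp add: P.prob_space)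
  qed (use prod[of "{b, c}"] in simp)
  then show ?thesis using that[of M \<epsilon>] P.prob_space_axioms sq prod[of "{_}"] by simp
qed


definition centered_field :: "'w measure \<Rightarrow> ('a \<Rightarrow> 'w \<Rightarrow> real) \<Rightarrow> ('a \<Rightarrow> 'a \<Rightarrow> real) \<Rightarrow> bool" where
  "centered_field M X K \<longleftrightarrow> prob_space M \<and>
     (\<forall>p. square_integrable M (X p) \<and> (\<integral>\<omega>. X p \<omega> \<partial>M) = 0) \<and>
     (\<forall>p q. (\<integral>\<omega>. X p \<omega> * X q \<omega> \<partial>M) = K p q)"

text \<open>Given \<open>K p q = \<Sum>b. \<phi>\<^sub>b(p) \<phi>\<^sub>b(q)\<close> and independent signs \<open>\<epsilon>\<^sub>b\<close>, the random series \<open>X\<^sub>p = \<Sum>b. \<phi>\<^sub>b(p) \<epsilon>\<^sub>b\<close> has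
covariance \<open>K\<close>. For each \<open>p\<close> the series is summed along finite sets \<open>A p k\<close> that increase fast enough for
\<open>L2_complete\<close>. The covariance then follows from \<open>E[X\<^sub>p \<epsilon>\<^sub>b] = \<phi>\<^sub>b(p)\<close> and the bound on residuals given by
Cauchy--Schwarz.\<close>

theorem pos_def_kernel_realizable:
  fixes K :: "'a \<Rightarrow> 'a \<Rightarrow> real"
  assumes K: "pos_def_kernel K"
  obtains M :: "(nat \<times> ('a \<Rightarrow> real) \<Rightarrow> bool) measure" and X where "centered_field M X K"
proof -
  obtain F where F: "subordinate K F" and diag: "\<And>p. ((\<lambda>b. (snd b p)\<^sup>2) has_sum K p p) F"
    using pos_def_kernel_decomposition[OF K] by blast
  obtain M :: "(nat \<times> ('a \<Rightarrow> real) \<Rightarrow> bool) measure" and \<epsilon> :: "nat \<times> ('a \<Rightarrow> real) \<Rightarrow> _"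
    where M: "prob_space M"
    and \<epsilon>: "\<And>b. square_integrable M (\<epsilon> b)" "\<And>b. (\<integral>\<omega>. \<epsilon> b \<omega> \<partial>M) = 0"
      "\<And>b c. (\<integral>\<omega>. \<epsilon> b \<omega> * \<epsilon> c \<omega> \<partial>M) = (if b = c then 1 else 0)"
    using independent_signs_exist[where ?'b = "nat \<times> ('a \<Rightarrow> real)"] by blast
  interpret prob_space M by (rule M)
  have "\<exists>A. (\<forall>k. finite (A k) \<and> A k \<subseteq> F) \<and> mono A \<and> (\<forall>k. residual K (A k) p p \<le> (1 / 4) ^ k)" for p
  proof -
    have "\<exists>G. finite G \<and> G \<subseteq> F \<and> (\<forall>H. finite H \<and> G \<subseteq> H \<and> H \<subseteq> F \<longrightarrow> residual K H p p \<le> (1 / 4) ^ k)" for k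
    proof -
      have "eventually (\<lambda>H. dist (\<Sum>b\<in>H. (snd b p)\<^sup>2) (K p p) < (1 / 4) ^ k) (finite_subsets_at_top F)"
        using diag[of p] by (intro tendstoD) (auto simp: has_sum_def)
      then obtain G where G: "finite G \<and> G \<subseteq> F \<and> (\<forall>H. finite H \<and> G \<subseteq> H \<and> H \<subseteq> F \<longrightarrow>
          dist (\<Sum>b\<in>H. (snd b p)\<^sup>2) (K p p) < (1 / 4) ^ k)"
        unfolding eventually_finite_subsets_at_top by (rule exE)
      have "residual K H p p \<le> (1 / 4) ^ k" if "finite H \<and> G \<subseteq> H \<and> H \<subseteq> F" for H
      proof -
        have "dist (\<Sum>b\<in>H. (snd b p)\<^sup>2) (K p p) < (1 / 4) ^ k" using G that by blast
        then show ?thesis unfolding residual_def dist_real_def power2_eq_square by linarith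
      qed
      with G show ?thesis by (intro exI[of _ G]) simp
    qed
    then obtain G where G: "\<And>k. finite (G k)" "\<And>k. G k \<subseteq> F"
      "\<And>k H. finite H \<Longrightarrow> G k \<subseteq> H \<Longrightarrow> H \<subseteq> F \<Longrightarrow> residual K H p p \<le> (1 / 4) ^ k"
      by metis
    show ?thesis
    proof (intro exI[of _ "\<lambda>k. \<Union>i\<le>k. G i"] conjI allI)
      show "mono (\<lambda>k. \<Union>i\<le>k. G i)" by (fastforce intro!: monoI)
      show "residual K (\<Union>i\<le>k. G i) p p \<le> (1 / 4) ^ k" for k
        by (rule G(3)) (use G in auto)
    qed (use G in auto)
  qed
  then obtain A where A: "\<And>p k. finite (A p k)" "\<And>p k. A p k \<subseteq> F" "\<And>p. mono (A p)"
      "\<And>p k. residual K (A p k) p p \<le> (1 / 4) ^ k"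
    by metis
  define S where "S p k \<omega> = (\<Sum>b\<in>A p k. snd b p * \<epsilon> b \<omega>)" for p k \<omega>
  have S_sq: "square_integrable M (S p k)" for p k
    unfolding S_def[abs_def] by (intro square_integrable_sum square_integrable_cmult \<epsilon>)
  have S_mult: "(\<integral>\<omega>. S p k \<omega> * Y \<omega> \<partial>M) = (\<Sum>b\<in>A p k. snd b p * (\<integral>\<omega>. \<epsilon> b \<omega> * Y \<omega> \<partial>M))"
    if "square_integrable M Y" for p k Y
    using square_integrable_mult[OF \<epsilon>(1) that] by (simp add: S_def sum_distrib_right mult.assoc)
  have S_cauchy: "(\<integral>\<omega>. (S p j \<omega> - S p k \<omega>)\<^sup>2 \<partial>M) \<le> (1 / 4) ^ k" if "k \<le> j" for p k j
  proof -
    have sub: "A p k \<subseteq> A p j" using A(3) that by (simp add: mono_def)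
    define D where "D = A p j - A p k"
    have D: "finite D" using A(1) by (simp add: D_def)
    have "S p j \<omega> - S p k \<omega> = (\<Sum>b\<in>D. snd b p * \<epsilon> b \<omega>)" for \<omega>
      using sub A(1) by (simp add: S_def D_def sum_diff)
    then have "(\<integral>\<omega>. (S p j \<omega> - S p k \<omega>)\<^sup>2 \<partial>M)
        = (\<integral>\<omega>. (\<Sum>b\<in>D. \<Sum>c\<in>D. snd b p * snd c p * (\<epsilon> b \<omega> * \<epsilon> c \<omega>)) \<partial>M)"
      by (simp add: power2_eq_square sum_product mult_ac)
    also have "\<dots> = (\<Sum>b\<in>D. \<Sum>c\<in>D. snd b p * snd c p * (if b = c then 1 else 0))"
      using square_integrable_mult[OF \<epsilon>(1) \<epsilon>(1)] by (simp add: \<epsilon>(3))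
    also have "\<dots> = (\<Sum>b\<in>D. snd b p * snd b p)"
      using D by (simp add: if_distrib[of "\<lambda>x. _ * x"] cong: if_cong)
    also have "\<dots> = residual K (A p k) p p - residual K (A p j) p p"
      using sub A(1) by (simp add: residual_def D_def sum_diff)
    also have "\<dots> \<le> (1 / 4) ^ k"
    proof -
      have "pos_def_kernel (residual K (A p j))" using F A(1,2) by (simp add: subordinate_def)
      from pos_def_kernel_diag[OF this, of p] A(4)[of p k] show ?thesis by linarith
    qed
    finally show ?thesis .
  qed
  have "\<exists>X. square_integrable M X \<and> (\<forall>k. (\<integral>\<omega>. (X \<omega> - S p k \<omega>)\<^sup>2 \<partial>M) \<le> (1 / 4) ^ k)" for p
  proof (rule L2_complete[of "S p", OF S_sq S_cauchy])
    fix h assume "square_integrable M h" "\<And>k. (\<integral>\<omega>. (h \<omega> - S p k \<omega>)\<^sup>2 \<partial>M) \<le> (1 / 4) ^ k"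
    then show ?thesis by (intro exI[of _ h]) simp
  qed
  then obtain X where X: "\<And>p. square_integrable M (X p)"
      "\<And>p k. (\<integral>\<omega>. (X p \<omega> - S p k \<omega>)\<^sup>2 \<partial>M) \<le> (1 / 4) ^ k"
    by metis
  have X_lim: "(\<lambda>k. \<integral>\<omega>. S p k \<omega> * Y \<omega> \<partial>M) \<longlonglongrightarrow> (\<integral>\<omega>. X p \<omega> * Y \<omega> \<partial>M)"
    if "square_integrable M Y" for p Y
    by (rule L2_limit_integral_mult[OF S_sq X(1) that X(2)])
  have X_mean: "(\<integral>\<omega>. X p \<omega> \<partial>M) = 0" for p
  proof -
    have one: "square_integrable M (\<lambda>_. 1)" by (simp add: square_integrable_def)
    show ?thesis
      using LIMSEQ_unique[OF X_lim[OF one, of p]] S_mult[OF one] by (simp add: \<epsilon>(2))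
  qed
  \<comment> \<open>An index \<open>c\<close> that never enters \<open>A p k\<close> has \<open>\<phi>\<^sub>c(p) = 0\<close>, since \<open>\<phi>\<^sub>c(p)\<^sup>2\<close> is bounded by every residual.\<close>
  have X_coeff: "(\<integral>\<omega>. X p \<omega> * \<epsilon> c \<omega> \<partial>M) = snd c p" if c: "c \<in> F" for p c
  proof -
    have "(\<lambda>k. if c \<in> A p k then snd c p else 0) \<longlonglongrightarrow> snd c p"
    proof (rule tendsto_of_power2_le)
      fix k
      show "((if c \<in> A p k then snd c p else 0) - snd c p)\<^sup>2 \<le> 1 * (1 / 4) ^ k"
      proof (cases "c \<in> A p k")
        case False
        have "(snd c p)\<^sup>2 + (\<Sum>b\<in>A p k. (snd b p)\<^sup>2) \<le> K p p"
          using subordinate_sum_le[OF F, of "insert c (A p k)" p] A(1,2) c False by simp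
        then show ?thesis using A(4)[of p k] False by (simp add: residual_def power2_eq_square)
      qed simp
    qed
    moreover have "(\<integral>\<omega>. S p k \<omega> * \<epsilon> c \<omega> \<partial>M) = (if c \<in> A p k then snd c p else 0)" for k
      using A(1) by (simp add: S_mult[OF \<epsilon>(1)] \<epsilon>(3) if_distrib[of "\<lambda>x. _ * x"] cong: if_cong)
    ultimately show ?thesis
      using LIMSEQ_unique[OF X_lim[OF \<epsilon>(1)[of c], of p]] by simp
  qed
  have "(\<integral>\<omega>. X p \<omega> * X q \<omega> \<partial>M) = K p q" for p q
  proof -
    have "(\<lambda>k. \<Sum>b\<in>A p k. snd b p * snd b q) \<longlonglongrightarrow> K p q"
    proof (rule tendsto_of_power2_le)
      fix k
      have PD: "pos_def_kernel (residual K (A p k))" using F A(1,2) by (simp add: subordinate_def)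
      have "((\<Sum>b\<in>A p k. snd b p * snd b q) - K p q)\<^sup>2 = (residual K (A p k) p q)\<^sup>2"
        by (simp add: residual_def power2_commute)
      also have "\<dots> \<le> residual K (A p k) p p * residual K (A p k) q q"
        by (rule pos_def_kernel_Cauchy_Schwarz[OF PD])
      also have "\<dots> \<le> (1 / 4) ^ k * K q q"
      proof (rule mult_mono)
        show "residual K (A p k) q q \<le> K q q" by (simp add: residual_def sum_nonneg)
      qed (use A(4) pos_def_kernel_diag[OF PD] in auto)
      finally show "((\<Sum>b\<in>A p k. snd b p * snd b q) - K p q)\<^sup>2 \<le> K q q * (1 / 4) ^ k"
        by (simp add: mult.commute)
    qed
    moreover have "(\<integral>\<omega>. S p k \<omega> * X q \<omega> \<partial>M) = (\<Sum>b\<in>A p k. snd b p * snd b q)" for k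
      unfolding S_mult[OF X(1)]
    proof (intro sum.cong refl)
      fix b assume "b \<in> A p k"
      then have "b \<in> F" using A(2) by blast
      then show "snd b p * (\<integral>\<omega>. \<epsilon> b \<omega> * X q \<omega> \<partial>M) = snd b p * snd b q"
        using X_coeff[of b q] by (simp add: mult.commute)
    qed
    ultimately show ?thesis
      using LIMSEQ_unique[OF X_lim[OF X(1)[of q], of p]] by simp
  qed
  then have "centered_field M X K"
    using M X(1) X_mean by (simp add: centered_field_def)
  then show ?thesis using that by blast
qed


section \<open>Products and exponentials of positive definite kernels\<close>

text \<open>Schur's product theorem: realise \<open>L\<close> as \<open>E[X\<^sub>p X\<^sub>q]\<close>; then the form of \<open>K L\<close> at \<open>c\<close> is the expectation of the
form of \<open>K\<close> at the random vector \<open>c\<^sub>p X\<^sub>p\<close>.\<close>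

lemma pos_def_kernel_mult:
  fixes K L :: "'a \<Rightarrow> 'a \<Rightarrow> real"
  assumes K: "pos_def_kernel K" and L: "pos_def_kernel L"
  shows "pos_def_kernel (\<lambda>p q. K p q * L p q)"
proof (rule pos_def_kernelI)
  fix p q
  show "K p q * L p q = K q p * L q p"
    using pos_def_kernel_sym[OF K, of p q] pos_def_kernel_sym[OF L, of p q] by simp
next
  obtain M :: "(nat \<times> ('a \<Rightarrow> real) \<Rightarrow> bool) measure" and X where X: "centered_field M X L"
    using L by (rule pos_def_kernel_realizable)
  have sq: "square_integrable M (X p)" for p
    using X by (simp add: centered_field_def)
  fix A :: "'a set" and c assume A: "finite A"
  have "0 \<le> (\<integral>\<omega>. (\<Sum>p\<in>A. \<Sum>q\<in>A. (c p * X p \<omega>) * (c q * X q \<omega>) * K p q) \<partial>M)"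
    by (intro Bochner_Integration.integral_nonneg pos_def_kernel_form_nonneg[OF K A])
  also have "\<dots> = (\<integral>\<omega>. (\<Sum>p\<in>A. \<Sum>q\<in>A. c p * c q * K p q * (X p \<omega> * X q \<omega>)) \<partial>M)"
    by (simp add: mult_ac)
  also have "\<dots> = (\<Sum>p\<in>A. \<Sum>q\<in>A. c p * c q * K p q * L p q)"
    using X square_integrable_mult[OF sq sq] by (simp add: centered_field_def)
  finally show "0 \<le> (\<Sum>p\<in>A. \<Sum>q\<in>A. c p * c q * (K p q * L p q))" by (simp add: mult.assoc)
qed

lemma pos_def_kernel_power:
  assumes "pos_def_kernel K"
  shows "pos_def_kernel (\<lambda>p q. K p q ^ n)"
proof (induction n)
  case 0
  show ?case using pos_def_kernel_rank_one[of "\<lambda>_. 1"] by simp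
next
  case (Suc n)
  show ?case unfolding power_Suc by (rule pos_def_kernel_mult[OF assms Suc])
qed

lemma pos_def_kernel_exp:
  assumes "pos_def_kernel K"
  shows "pos_def_kernel (\<lambda>p q. exp (K p q))"
proof (rule pos_def_kernel_limit[of sequentially])
  show "(\<lambda>n. \<Sum>k<n. inverse (fact k) * K p q ^ k) \<longlonglongrightarrow> exp (K p q)" for p q
    using exp_converges[of "K p q"] by (simp add: sums_def)
  show "\<forall>\<^sub>F n in sequentially. pos_def_kernel (\<lambda>p q. \<Sum>k<n. inverse (fact k) * K p q ^ k)"
    by (intro always_eventually allI pos_def_kernel_sum pos_def_kernel_scale pos_def_kernel_power assms) simp
qed simp

text \<open>The kernel \<open>E\<^sub>t = exp (- t D)\<close> satisfies \<open>E\<^sub>t s s = 1\<close>, so \<open>E\<^sub>t p q - E\<^sub>t p s E\<^sub>t q s\<close> is its Schur complement at \<open>s\<close>.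
It vanishes at \<open>t = 0\<close>, and its derivative there, the limit of positive multiples of it, is the claimed
kernel.\<close>

lemma pos_def_kernel_log_derivative:
  fixes D :: "'a \<Rightarrow> 'a \<Rightarrow> real"
  assumes PD: "\<And>t. t > 0 \<Longrightarrow> pos_def_kernel (\<lambda>p q. exp (- t * D p q))" and s: "D s s = 0"
  shows "pos_def_kernel (\<lambda>p q. D p s + D q s - D p q)"
proof (rule pos_def_kernel_limit[of "at_right 0"])
  fix p q
  have exp_sum_split: "exp (- (t * (D p s + D q s))) = exp (- (t * D p s)) * exp (- (t * D q s))" for t
    by (simp only: mult_exp_exp distrib_left minus_add_distrib)
  have "((\<lambda>t. exp (- t * D p q) - exp (- t * (D p s + D q s))) has_field_derivative (D p s + D q s - D p q)) (at 0)"
    by (auto intro!: derivative_eq_intros)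
  then have "((\<lambda>t. (exp (- t * D p q) - exp (- t * (D p s + D q s))) / t) \<longlongrightarrow> D p s + D q s - D p q) (at 0)"
    by (simp add: DERIV_def)
  then have "((\<lambda>t. (exp (- t * D p q) - exp (- t * (D p s + D q s))) / t) \<longlongrightarrow> D p s + D q s - D p q) (at_right 0)"
    by (rule tendsto_mono[rotated]) (simp add: at_le)
  then show "((\<lambda>t. 1 / t * (exp (- t * D p q) - exp (- t * D p s) * exp (- t * D q s) / exp (- t * D s s)))
      \<longlongrightarrow> D p s + D q s - D p q) (at_right 0)"
    by (simp add: s exp_sum_split)
next
  show "\<forall>\<^sub>F t in at_right 0.
      pos_def_kernel (\<lambda>p q. 1 / t * (exp (- t * D p q) - exp (- t * D p s) * exp (- t * D q s) / exp (- t * D s s)))"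
    using eventually_at_right_less[of 0]
  proof eventually_elim
    case (elim t)
    show ?case
      by (intro pos_def_kernel_scale pos_def_kernel_deflate PD) (use elim in auto)
  qed
qed simp

section \<open>Vector-valued fields on Euclidean space\<close>

lemma centered_fieldD:
  assumes "centered_field M X K"
  shows "prob_space M" "square_integrable M (X p)" "(\<integral>\<omega>. X p \<omega> \<partial>M) = 0"
    "(\<integral>\<omega>. X p \<omega> * X q \<omega> \<partial>M) = K p q"
  using assms unfolding centered_field_def by blast+

lemma centered_field_increments:
  assumes "centered_field M X K"
  shows "centered_field M (\<lambda>p \<omega>. X (f p) \<omega> - X (g p) \<omega>)
    (\<lambda>p q. K (f p) (f q) - K (f p) (g q) - K (g p) (f q) + K (g p) (g q))"
proof -
  interpret prob_space M using assms by (simp add: centered_field_def)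
  have sq: "square_integrable M (X p)" and mean: "(\<integral>\<omega>. X p \<omega> \<partial>M) = 0"
    and cov: "(\<integral>\<omega>. X p \<omega> * X q \<omega> \<partial>M) = K p q" for p q
    by (rule centered_fieldD[OF assms])+
  have int: "integrable M (X p)" for p
    using sq by (auto simp: square_integrable_def intro: square_integrable_imp_integrable)
  have "(\<integral>\<omega>. (X (f p) \<omega> - X (g p) \<omega>) * (X (f q) \<omega> - X (g q) \<omega>) \<partial>M)
      = (\<integral>\<omega>. X (f p) \<omega> * X (f q) \<omega> - X (f p) \<omega> * X (g q) \<omega> - X (g p) \<omega> * X (f q) \<omega> + X (g p) \<omega> * X (g q) \<omega> \<partial>M)"
    for p q by (simp add: algebra_simps)
  also have "\<dots> p q = K (f p) (f q) - K (f p) (g q) - K (g p) (f q) + K (g p) (g q)" for p q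
    using square_integrable_mult[OF sq sq] by (simp add: cov)
  finally show ?thesis
    using prob_space_axioms square_integrable_diff[OF sq sq] int by (simp add: centered_field_def mean)
qed

lemma measurable_vec:
  fixes f :: "'w \<Rightarrow> real ^ 'm"
  assumes "\<And>i. (\<lambda>\<omega>. f \<omega> $ i) \<in> borel_measurable M"
  shows "f \<in> borel_measurable M"
  by (rule borel_measurable_euclidean_space[THEN iffD2]) (use assms in \<open>auto simp: Basis_vec_def inner_axis\<close>)

lemma integral_vec_zero:
  fixes f :: "'w \<Rightarrow> real ^ 'm"
  assumes int: "\<And>i. integrable M (\<lambda>\<omega>. f \<omega> $ i)" and zero: "\<And>i. (\<integral>\<omega>. f \<omega> $ i \<partial>M) = 0"
  shows "integral\<^sup>L M f = 0"
proof -
  have f: "f = (\<lambda>\<omega>. \<Sum>i\<in>UNIV. (f \<omega> $ i) *\<^sub>R axis i 1)"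
    by (simp add: vec_eq_iff axis_def if_distrib[of "\<lambda>x. _ * x"] fun_eq_iff cong: if_cong)
  show ?thesis by (subst f) (simp add: int zero)
qed

lemma centered_field_stationary:
  fixes Z :: "real ^ 'd \<Rightarrow> 'w \<Rightarrow> real ^ 'm"
  assumes Z: "centered_field M (\<lambda>p \<omega>. Z (fst p) \<omega> $ snd p) K"
    and K: "\<And>x h i j. K (x + h, i) (x, j) = C h $ i $ j"
  shows "second_order_stationary M Z" "has_covariance_function M Z C"
proof -
  interpret prob_space M using Z by (simp add: centered_field_def)
  have sq: "square_integrable M (\<lambda>\<omega>. Z x \<omega> $ i)" and mean: "(\<integral>\<omega>. Z x \<omega> $ i \<partial>M) = 0" for x i
    using centered_fieldD(2,3)[OF Z, of "(x, i)"] by simp_all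
  have cov: "(\<integral>\<omega>. Z (x + h) \<omega> $ i * Z x \<omega> $ j \<partial>M) = C h $ i $ j" for x h i j
    using centered_fieldD(4)[OF Z, of "(x + h, i)" "(x, j)"] by (simp add: K)
  have meas: "(\<lambda>\<omega>. Z x \<omega> $ i) \<in> borel_measurable M" for x i
    using sq by (simp add: square_integrable_def)
  show C: "has_covariance_function M Z C"
    by (simp add: has_covariance_function_def covariance_def sq mean cov)
  have "integral\<^sup>L M (Z x) = 0" for x
    using sq meas mean
    by (intro integral_vec_zero) (auto simp: square_integrable_def intro: square_integrable_imp_integrable)
  moreover have "random_field M Z"
    by (simp add: random_field_def prob_space_axioms measurable_vec meas)
  ultimately show "second_order_stationary M Z"
    using C by (auto simp: second_order_stationary_def)
qed

text \<open>An \<open>m\<close>-variate field on \<open>real ^ 'd\<close> is a scalar field on the index set \<open>(real ^ 'd) \<times> 'm\<close>, so matrix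
correlation functions are exactly the normalised positive definite kernels on that set that depend on
the locations through their difference only.\<close>

lemma matrix_correlation_function_iff_pos_def:
  fixes C :: "real ^ 'd \<Rightarrow> real ^ 'm ^ 'm"
  shows "matrix_correlation_function C \<longleftrightarrow>
    pos_def_kernel (\<lambda>p q. C (fst p - fst q) $ snd p $ snd q) \<and> (\<forall>i. C 0 $ i $ i = 1)"
proof (intro iffI conjI)
  assume C: "matrix_correlation_function C"
  then have "\<exists>(M :: (real ^ 'd \<Rightarrow> real ^ 'm) measure) Z. second_order_stationary M Z \<and> has_covariance_function M Z C"
    unfolding matrix_correlation_function_def by (rule conjunct1)
  then obtain M :: "(real ^ 'd \<Rightarrow> real ^ 'm) measure" and Z
    where "second_order_stationary M Z \<and> has_covariance_function M Z C"
    by (elim exE) (rule that)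
  then have st: "second_order_stationary M Z" and cov_fun: "has_covariance_function M Z C" by simp_all
  have sq: "square_integrable M (\<lambda>\<omega>. Z x \<omega> $ i)"
    and cov: "covariance M (\<lambda>\<omega>. Z (x + h) \<omega> $ i) (\<lambda>\<omega>. Z x \<omega> $ j) = C h $ i $ j" for x h i j
    using cov_fun by (simp_all add: has_covariance_function_def)
  interpret prob_space M using st by (simp add: second_order_stationary_def random_field_def)
  define W where "W p \<omega> = Z (fst p) \<omega> $ snd p - (\<integral>\<omega>. Z (fst p) \<omega> $ snd p \<partial>M)" for p \<omega>
  have const: "square_integrable M (\<lambda>_. a)" for a by (simp add: square_integrable_def)
  have "square_integrable M (W p)" for p
    unfolding W_def[abs_def] by (intro square_integrable_diff sq const)
  moreover have "(\<integral>\<omega>. W p \<omega> * W q \<omega> \<partial>M) = C (fst p - fst q) $ snd p $ snd q" for p q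
    using cov[of "fst q" "fst p - fst q" "snd p" "snd q"] by (simp add: covariance_def W_def)
  ultimately show "pos_def_kernel (\<lambda>p q. C (fst p - fst q) $ snd p $ snd q)"
    using pos_def_kernel_second_moments[of M W] by simp
  show "\<forall>i. C 0 $ i $ i = 1" using C unfolding matrix_correlation_function_def by (rule conjunct2)
next
  assume *: "pos_def_kernel (\<lambda>p q. C (fst p - fst q) $ snd p $ snd q) \<and> (\<forall>i. C 0 $ i $ i = 1)"
  obtain M :: "(nat \<times> ((real ^ 'd) \<times> 'm \<Rightarrow> real) \<Rightarrow> bool) measure" and X
    where X: "centered_field M X (\<lambda>p q. C (fst p - fst q) $ snd p $ snd q)"
    using *[THEN conjunct1] by (rule pos_def_kernel_realizable)
  define Z where "Z x \<omega> = (\<chi> i. X (x, i) \<omega>)" for x \<omega>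
  have "centered_field M (\<lambda>p \<omega>. Z (fst p) \<omega> $ snd p) (\<lambda>p q. C (fst p - fst q) $ snd p $ snd q)"
    using X by (simp add: Z_def)
  from centered_field_stationary[OF this, of C] show "matrix_correlation_function C"
    using * by (intro matrix_correlation_functionI) auto
qed

text \<open>The second moments of \<open>Z\<^sub>i(x)\<close> itself need not exist, but those of its differences with one fixed
component at the origin do. After centring, they form a kernel \<open>V\<close>, and \<open>\<gamma>\<close> is half
the variance of a difference of two such variables.\<close>

lemma pseudo_variogram_imp_pos_def:
  fixes \<gamma> :: "real ^ 'd \<Rightarrow> real ^ 'm ^ 'm"
  assumes "is_pseudo_variogram \<gamma>"
  obtains V where "pos_def_kernel V"
    "\<And>p q. \<gamma> (fst p - fst q) $ snd p $ snd q = (V p p + V q q) / 2 - V p q"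
proof -
  obtain M :: "(real ^ 'd \<Rightarrow> real ^ 'm) measure" and Z where Z: "has_pseudo_variogram M Z \<gamma>"
    using assms unfolding is_pseudo_variogram_def by (elim exE) (rule that)
  interpret prob_space M
    using Z by (simp add: has_pseudo_variogram_def intrinsically_stationary_def random_field_def)
  have sq: "square_integrable M (\<lambda>\<omega>. Z x \<omega> $ i - Z y \<omega> $ j)"
    and var: "\<gamma> (x - y) $ i $ j = 1 / 2 * variance (\<lambda>\<omega>. Z x \<omega> $ i - Z y \<omega> $ j)" for x y i j
  proof -
    have "square_integrable M (\<lambda>\<omega>. Z (y + h) \<omega> $ i - Z y \<omega> $ j) \<and>
        \<gamma> h $ i $ j = 1 / 2 * variance (\<lambda>\<omega>. Z (y + h) \<omega> $ i - Z y \<omega> $ j)" for h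
      using Z by (simp add: has_pseudo_variogram_def)
    from this[of "x - y"] show "square_integrable M (\<lambda>\<omega>. Z x \<omega> $ i - Z y \<omega> $ j)"
      "\<gamma> (x - y) $ i $ j = 1 / 2 * variance (\<lambda>\<omega>. Z x \<omega> $ i - Z y \<omega> $ j)"
      by simp_all
  qed
  define U where "U p \<omega> = Z (fst p) \<omega> $ snd p - Z 0 \<omega> $ undefined" for p \<omega>
  define W where "W p \<omega> = U p \<omega> - expectation (U p)" for p \<omega>
  have U: "square_integrable M (U p)" for p unfolding U_def[abs_def] by (rule sq)
  have U_int: "integrable M (U p)" for p
    using U[of p] by (auto simp: square_integrable_def intro: square_integrable_imp_integrable)
  have const: "square_integrable M (\<lambda>_. a)" for a by (simp add: square_integrable_def)
  have W: "square_integrable M (W p)" for p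
    unfolding W_def[abs_def] by (intro square_integrable_diff U const)
  define V where "V p q = expectation (\<lambda>\<omega>. W p \<omega> * W q \<omega>)" for p q
  have "\<gamma> (fst p - fst q) $ snd p $ snd q = (V p p + V q q) / 2 - V p q" for p q
  proof -
    have diff: "Z (fst p) \<omega> $ snd p - Z (fst q) \<omega> $ snd q = U p \<omega> - U q \<omega>" for \<omega>
      by (simp add: U_def)
    have "U p \<omega> - U q \<omega> - expectation (\<lambda>\<omega>. U p \<omega> - U q \<omega>) = W p \<omega> - W q \<omega>" for \<omega>
      by (simp add: W_def U_int)
    then have "\<gamma> (fst p - fst q) $ snd p $ snd q = 1 / 2 * expectation (\<lambda>\<omega>. (W p \<omega> - W q \<omega>)\<^sup>2)"
      unfolding var diff by simp
    also have "expectation (\<lambda>\<omega>. (W p \<omega> - W q \<omega>)\<^sup>2)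
        = expectation (\<lambda>\<omega>. W p \<omega> * W p \<omega> + W q \<omega> * W q \<omega> - 2 * (W p \<omega> * W q \<omega>))"
      by (simp add: power2_eq_square algebra_simps)
    also have "\<dots> = V p p + V q q - 2 * V p q"
      using square_integrable_mult[OF W W] by (simp add: V_def)
    also have "1 / 2 * (V p p + V q q - 2 * V p q) = (V p p + V q q) / 2 - V p q"
      by (simp add: diff_divide_distrib)
    finally show ?thesis .
  qed
  moreover have "pos_def_kernel V"
    unfolding V_def[abs_def] by (rule pos_def_kernel_second_moments[OF W])
  ultimately show ?thesis using that by blast
qed

text \<open>Let \<open>X\<close> be a field with the given covariance. All terms \<open>D p s\<close> cancel in the covariances of increments of \<open>X\<close>,
which therefore depend on differences of locations only, and \<open>D p p = 0\<close> makes the variance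
of \<open>X\<^sub>p - X\<^sub>q\<close> equal to \<open>2 D p q\<close>.\<close>

lemma pos_def_imp_pseudo_variogram:
  fixes \<gamma> :: "real ^ 'd \<Rightarrow> real ^ 'm ^ 'm"
  defines "D \<equiv> \<lambda>p q. \<gamma> (fst p - fst q) $ snd p $ snd q"
  assumes PD: "pos_def_kernel (\<lambda>p q. D p s + D q s - D p q)"
    and zero: "\<And>i. \<gamma> 0 $ i $ i = 0"
  shows "is_pseudo_variogram \<gamma>"
proof -
  define K where "K p q = D p s + D q s - D p q" for p q
  have "pos_def_kernel K" using PD by (simp add: K_def[abs_def])
  have K_sym: "K p q = K q p" for p q by (rule pos_def_kernel_sym) fact
  obtain M :: "(nat \<times> ((real ^ 'd) \<times> 'm \<Rightarrow> real) \<Rightarrow> bool) measure" and X where X: "centered_field M X K"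
    using \<open>pos_def_kernel K\<close> by (rule pos_def_kernel_realizable)
  define Z where "Z x \<omega> = (\<chi> i. X (x, i) \<omega>)" for x \<omega>
  have D_diag: "D p p = 0" for p by (simp add: D_def zero)
  have field: "prob_space M" and sq: "\<And>p. square_integrable M (X p)"
    using X by (auto simp: centered_field_def)
  have rf: "random_field M Z"
    using field sq by (auto simp: random_field_def Z_def square_integrable_def intro!: measurable_vec)
  have "second_order_stationary M (\<lambda>x \<omega>. Z (x + h) \<omega> - Z x \<omega>)" for h
  proof (rule centered_field_stationary(1))
    define f :: "(real ^ 'd) \<times> 'm \<Rightarrow> (real ^ 'd) \<times> 'm" where "f p = (fst p + h, snd p)" for p
    show "centered_field M (\<lambda>p \<omega>. (Z (fst p + h) \<omega> - Z (fst p) \<omega>) $ snd p)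
        (\<lambda>p q. K (f p) (f q) - K (f p) q - K p (f q) + K p q)"
      using centered_field_increments[OF X, of f "\<lambda>p. p"] by (simp add: Z_def f_def)
    show "K (f (x + k, i)) (f (x, j)) - K (f (x + k, i)) (x, j) - K (x + k, i) (f (x, j)) + K (x + k, i) (x, j)
        = (\<chi> i j. \<gamma> (k + h) $ i $ j + \<gamma> (k - h) $ i $ j - 2 * \<gamma> k $ i $ j) $ i $ j" for x k i j
      by (simp add: K_def D_def f_def algebra_simps)
  qed
  moreover have "square_integrable M (\<lambda>\<omega>. Z x \<omega> $ i - Z y \<omega> $ j)" for x y i j
    by (simp add: Z_def square_integrable_diff sq)
  moreover have "\<gamma> h $ i $ j = 1 / 2 * prob_space.variance M (\<lambda>\<omega>. Z (x + h) \<omega> $ i - Z x \<omega> $ j)" for x h i j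
  proof -
    define p q where "p = (x + h, i)" and "q = (x, j)"
    \<comment> \<open>A single increment, viewed as a field with one index, gives its variance.\<close>
    have inc: "centered_field M (\<lambda>_ :: unit. \<lambda>\<omega>. X p \<omega> - X q \<omega>) (\<lambda>_ _. K p p - K p q - K q p + K q q)"
      using centered_field_increments[OF X, of "\<lambda>_. p" "\<lambda>_. q"] .
    then have "prob_space.variance M (\<lambda>\<omega>. X p \<omega> - X q \<omega>) = K p p - K p q - K q p + K q q"
      by (simp add: centered_field_def power2_eq_square)
    also have "\<dots> = 2 * D p q"
      unfolding K_sym[of q p] by (simp add: K_def D_diag)
    finally show ?thesis by (simp add: Z_def D_def p_def q_def)
  qed
  ultimately have "has_pseudo_variogram M Z \<gamma>"
    using rf by (simp add: has_pseudo_variogram_def intrinsically_stationary_def)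
  then show ?thesis by (rule is_pseudo_variogramI)
qed

section \<open>Pseudo-variograms and matrix-valued correlation functions\<close>

theorem corollary3p4:
  fixes \<gamma> :: "real ^ 'd \<Rightarrow> real ^ 'm ^ 'm"
  shows "is_pseudo_variogram \<gamma> \<longleftrightarrow>
    (\<forall>t::real. t > 0 \<longrightarrow> matrix_correlation_function (\<lambda>h. exp_star (- t *\<^sub>R \<gamma> h)))"
proof
  assume "is_pseudo_variogram \<gamma>"
  then obtain V where V: "pos_def_kernel V"
    and \<gamma>: "\<And>p q. \<gamma> (fst p - fst q) $ snd p $ snd q = (V p p + V q q) / 2 - V p q"
    by (rule pseudo_variogram_imp_pos_def) (rule that)
  show "\<forall>t::real. t > 0 \<longrightarrow> matrix_correlation_function (\<lambda>h. exp_star (- t *\<^sub>R \<gamma> h))"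
  proof (intro allI impI)
    fix t :: real assume t: "t > 0"
    \<comment> \<open>\<open>exp (- t \<gamma>) = f(p) f(q) exp (t V p q)\<close> since \<open>\<gamma> = (V p p + V q q) / 2 - V p q\<close>\<close>
    define f where "f p = exp (- t * V p p / 2)" for p
    have "exp_star (- t *\<^sub>R \<gamma> (fst p - fst q)) $ snd p $ snd q = f p * f q * exp (t * V p q)" for p q
      by (simp add: exp_star_def \<gamma> f_def exp_add[symmetric] algebra_simps add_divide_distrib)
    moreover have "pos_def_kernel (\<lambda>p q. f p * f q * exp (t * V p q))"
      using t by (intro pos_def_kernel_congruence pos_def_kernel_exp pos_def_kernel_scale V) simp
    moreover have "exp_star (- t *\<^sub>R \<gamma> 0) $ i $ i = 1" for i
      using \<gamma>[of "(0, i)" "(0, i)"] by (simp add: exp_star_def)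
    ultimately show "matrix_correlation_function (\<lambda>h. exp_star (- t *\<^sub>R \<gamma> h))"
      by (simp add: matrix_correlation_function_iff_pos_def)
  qed
next
  assume R: "\<forall>t::real. t > 0 \<longrightarrow> matrix_correlation_function (\<lambda>h. exp_star (- t *\<^sub>R \<gamma> h))"
  have zero: "\<gamma> 0 $ i $ i = 0" for i
    using R[rule_format, of 1] by (simp add: matrix_correlation_function_iff_pos_def exp_star_def)
  define D where "D p q = \<gamma> (fst p - fst q) $ snd p $ snd q" for p q
  have PD: "pos_def_kernel (\<lambda>p q. exp (- t * D p q))" if "t > 0" for t
    using R[rule_format, OF that] by (simp add: matrix_correlation_function_iff_pos_def exp_star_def D_def)
  have "pos_def_kernel (\<lambda>p q. D p (0, undefined) + D q (0, undefined) - D p q)"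
    by (rule pos_def_kernel_log_derivative[OF PD]) (simp_all add: D_def zero)
  then show "is_pseudo_variogram \<gamma>"
    unfolding D_def by (rule pos_def_imp_pseudo_variogram) (rule zero)
qed

end
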